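(* Let $G$ be a group with identity element $e$ and let $R$ be a (not necessarily unital) $G$-graded ring. If the $G$-grading on $R$ is non-degenerate and $R_e$ is a domain, then the $G$-grading is fully component regular.
   Context: Rings are associative, not necessarily commutative. A ring $R$ is $G$-graded if there is a collection $\{R_g\}_{g\in G}$ of additive subgroups of $R$ such that $R=\oplus_{g\in G}R_g$ and $R_gR_h\subseteq R_{gh}$ for all $g,h\in G$. The $G$-grading is non-degenerate if, for each $g\in G$ and each nonzero $r_g\in R_g$, we have $r_gR_{g^{-1}}\neq\{0\}$ and $R_{g^{-1}}r_g\neq\{0\}$. The $G$-grading is fully component regular if $r_gs_h\neq 0$ for any $g,h\in G$, $r_g\in R_g\setminus\{0\}$ and $s_h\in R_h\setminus\{0\}$. A domain is a nonzero (not necessarily commutative or unital) ring in which the product of any two nonzero elements is nonzero. *)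

theory Defs
  imports "HOL-Algebra.Group"
begin

text \<open>
  The class \<open>ring\<close> of HOL consists of associative rings that need be neither commutative nor
  unital, whereas rings in HOL-Algebra are unital. So the graded ring is (the universe of) a
  type of class \<open>ring\<close>, and the grading group is a group of HOL-Algebra.
\<close>

definition add_subgroup :: "'a::ring set \<Rightarrow> bool" where
  "add_subgroup S \<longleftrightarrow>
     0 \<in> S \<and> (\<forall>x\<in>S. \<forall>y\<in>S. x + y \<in> S) \<and> (\<forall>x\<in>S. - x \<in> S)"

text \<open>
  A decomposition of an element along a family of additive subgroups is a finitely supported
  choice of one component in each of them. It is set to zero outside the index set, so that
  uniqueness can be stated as uniqueness of a total function.
\<close>

definition is_decomposition :: "'i set \<Rightarrow> ('i \<Rightarrow> 'a::ring set) \<Rightarrow> 'a \<Rightarrow> ('i \<Rightarrow> 'a) \<Rightarrow> bool" where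
  "is_decomposition I A r f \<longleftrightarrow>
     (\<forall>i\<in>I. f i \<in> A i) \<and> (\<forall>i. i \<notin> I \<longrightarrow> f i = 0) \<and>
     finite {i. f i \<noteq> 0} \<and> r = (\<Sum>i\<in>{i. f i \<noteq> 0}. f i)"

locale graded_ring = group G for G :: "('g, 'm) monoid_scheme" (structure) +
  fixes R :: "'g \<Rightarrow> 'a::ring set"
  assumes component_add_subgroup: "g \<in> carrier G \<Longrightarrow> add_subgroup (R g)"
    and direct_sum: "\<exists>!f. is_decomposition (carrier G) R r f"
    and component_mult:
      "\<lbrakk>g \<in> carrier G; h \<in> carrier G; x \<in> R g; y \<in> R h\<rbrakk> \<Longrightarrow> x * y \<in> R (g \<otimes> h)"

definition nondegenerate_grading ::
    "('g, 'm) monoid_scheme \<Rightarrow> ('g \<Rightarrow> 'a::ring set) \<Rightarrow> bool" where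
  "nondegenerate_grading G R \<longleftrightarrow>
     (\<forall>g\<in>carrier G. \<forall>r\<in>R g. r \<noteq> 0 \<longrightarrow>
        {r * s | s. s \<in> R (inv\<^bsub>G\<^esub> g)} \<noteq> {0} \<and> {s * r | s. s \<in> R (inv\<^bsub>G\<^esub> g)} \<noteq> {0})"

definition fully_component_regular ::
    "('g, 'm) monoid_scheme \<Rightarrow> ('g \<Rightarrow> 'a::ring set) \<Rightarrow> bool" where
  "fully_component_regular G R \<longleftrightarrow>
     (\<forall>g\<in>carrier G. \<forall>h\<in>carrier G. \<forall>r\<in>R g - {0}. \<forall>s\<in>R h - {0}. r * s \<noteq> 0)"

definition is_subring :: "'a::ring set \<Rightarrow> bool" where
  "is_subring S \<longleftrightarrow> add_subgroup S \<and> (\<forall>x\<in>S. \<forall>y\<in>S. x * y \<in> S)"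

definition is_domain :: "'a::ring set \<Rightarrow> bool" where
  "is_domain S \<longleftrightarrow>
     is_subring S \<and> S \<noteq> {0} \<and> (\<forall>x\<in>S. \<forall>y\<in>S. x \<noteq> 0 \<longrightarrow> y \<noteq> 0 \<longrightarrow> x * y \<noteq> 0)"

lemma (in graded_ring) identity_component_subring: "is_subring (R \<one>)"
  unfolding is_subring_def
  using component_add_subgroup[of \<one>] component_mult[of \<one> \<one>] by simp

end

theory Submission
  imports Defs
begin

text \<open>
  Non-degeneracy moves a hypothetical zero product of homogeneous elements into the identity
  component. If \<open>r\<close> and \<open>s\<close> are nonzero homogeneous elements, there are homogeneous \<open>a\<close> and \<open>b\<close>
  of inverse degrees such that \<open>a * r\<close> and \<open>s * b\<close> are nonzero; both have degree \<open>\<one>\<close>. If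
  \<open>r * s\<close> were \<open>0\<close>, then \<open>(a * r) * (s * b) = a * (r * s) * b = 0\<close> would be a zero product of
  nonzero elements of the domain \<open>R \<one>\<close>.
\<close>

context graded_ring
begin

text \<open>
  Non-degeneracy says only that a set of products differs from \<open>{0}\<close>. As \<open>0\<close> lies in every
  component, that set contains \<open>0\<close>, so it differs from \<open>{0}\<close> by having a nonzero element.
\<close>

lemma nondegenerate_left_multiplier:
  assumes "nondegenerate_grading G R" "g \<in> carrier G" "r \<in> R g" "r \<noteq> 0"
  obtains a where "a \<in> R (inv g)" "a * r \<in> R \<one>" "a * r \<noteq> 0"
proof -
  have "0 \<in> R (inv g)"
    using component_add_subgroup[of "inv g"] assms(2) by (simp add: add_subgroup_def)
  then have "0 \<in> {a * r | a. a \<in> R (inv g)}"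
    by (auto intro!: exI[of _ 0])
  moreover have "{a * r | a. a \<in> R (inv g)} \<noteq> {0}"
    using assms unfolding nondegenerate_grading_def by blast
  ultimately obtain a where a: "a \<in> R (inv g)" "a * r \<noteq> 0"
    by blast
  moreover have "a * r \<in> R \<one>"
    using component_mult[of "inv g" g a r] assms(2,3) a(1) by simp
  ultimately show thesis
    using that by blast
qed

lemma nondegenerate_right_multiplier:
  assumes "nondegenerate_grading G R" "g \<in> carrier G" "r \<in> R g" "r \<noteq> 0"
  obtains b where "b \<in> R (inv g)" "r * b \<in> R \<one>" "r * b \<noteq> 0"
proof -
  have "0 \<in> R (inv g)"
    using component_add_subgroup[of "inv g"] assms(2) by (simp add: add_subgroup_def)
  then have "0 \<in> {r * b | b. b \<in> R (inv g)}"
    by (auto intro!: exI[of _ 0])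
  moreover have "{r * b | b. b \<in> R (inv g)} \<noteq> {0}"
    using assms unfolding nondegenerate_grading_def by blast
  ultimately obtain b where b: "b \<in> R (inv g)" "r * b \<noteq> 0"
    by blast
  moreover have "r * b \<in> R \<one>"
    using component_mult[of g "inv g" r b] assms(2,3) b(1) by simp
  ultimately show thesis
    using that by blast
qed

end

theorem proposition2p6:
  fixes G :: "('g, 'm) monoid_scheme" and R :: "'g \<Rightarrow> 'a::ring set"
  assumes "group G"
    and "graded_ring G R"
    and "nondegenerate_grading G R"
    and "is_domain (R \<one>\<^bsub>G\<^esub>)"
  shows "fully_component_regular G R"
proof -
  interpret graded_ring G R by fact
  have "r * s \<noteq> 0"
    if g: "g \<in> carrier G" and h: "h \<in> carrier G"
      and r: "r \<in> R g" "r \<noteq> 0" and s: "s \<in> R h" "s \<noteq> 0" for g h r s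
  proof
    assume "r * s = 0"
    obtain a where a: "a * r \<in> R \<one>\<^bsub>G\<^esub>" "a * r \<noteq> 0"
      using nondegenerate_left_multiplier[OF assms(3) g r] .
    obtain b where b: "s * b \<in> R \<one>\<^bsub>G\<^esub>" "s * b \<noteq> 0"
      using nondegenerate_right_multiplier[OF assms(3) h s] .
    have "(a * r) * (s * b) = a * (r * s) * b"
      by (simp only: mult.assoc)
    also have "\<dots> = 0"
      using \<open>r * s = 0\<close> by simp
    finally show False
      using assms(4) a b unfolding is_domain_def by blast
  qed
  then show ?thesis
    unfolding fully_component_regular_def by blast
qed

end
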